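(* For every integer $n\geq 2$, $$x\,C_{n}(x)=(1+x)\,T_n(x),$$ where $C_n(x)=xW_n(x^2)+\widetilde{W}_n(x^2)$.
   Context: $\mathfrak{S}_n$ is the set of permutations $\pi=\pi(1)\cdots\pi(n)$ of $\{1,\ldots,n\}$. An interior peak of $\pi\in\mathfrak{S}_n$ is an index $i\in\{2,\ldots,n-1\}$ with $\pi(i-1)<\pi(i)>\pi(i+1)$; a left peak is an index $i\in\{1,\ldots,n-1\}$ with $\pi(i-1)<\pi(i)>\pi(i+1)$, where $\pi(0)=0$. $W(n,k)$ (resp. $\widetilde{W}(n,k)$) is the number of $\pi\in\mathfrak{S}_n$ with $k$ interior peaks (resp. $k$ left peaks); $W_n(x)=\sum_{k\ge 0}W(n,k)x^k$ and $\widetilde{W}_n(x)=\sum_{k\ge 0}\widetilde{W}(n,k)x^k$. An alternating subsequence of $\pi$ of length $k$ is a subsequence $\pi(i_1),\ldots,\pi(i_k)$ with $i_1<\cdots<i_k$ and $\pi(i_1)>\pi(i_2)<\pi(i_3)>\cdots\pi(i_k)$ (starting with a descent and alternating thereafter; any sequence of length 1 qualifies). $\mathrm{as}(\pi)$ is the maximal length of an alternating subsequence of $\pi$, $a_k(n)=\#\{\pi\in\mathfrak{S}_n:\mathrm{as}(\pi)=k\}$, and $T_n(x)=\sum_{k=1}^n a_k(n)x^k$. *)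

theory Defs
  imports "HOL-Combinatorics.Permutations" "HOL-Computational_Algebra.Polynomial"
begin

text \<open>
  Permutations of \<open>{1..n}\<close> are the functions \<open>p\<close> with \<open>p permutes {1..n}\<close>.  Such a function
  fixes 0, so the convention \<open>p 0 = 0\<close> used for left peaks holds automatically.
\<close>

lemma permutes_zero:
  assumes "p permutes {1..n::nat}"
  shows "p 0 = 0"
  using assms by (simp add: permutes_def)

definition interior_peaks :: "nat \<Rightarrow> (nat \<Rightarrow> nat) \<Rightarrow> nat set" where
  "interior_peaks n p = {i \<in> {2..n - 1}. p (i - 1) < p i \<and> p i > p (i + 1)}"

definition left_peaks :: "nat \<Rightarrow> (nat \<Rightarrow> nat) \<Rightarrow> nat set" where
  "left_peaks n p = {i \<in> {1..n - 1}. p (i - 1) < p i \<and> p i > p (i + 1)}"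

definition W :: "nat \<Rightarrow> nat \<Rightarrow> nat" where
  "W n k = card {p. p permutes {1..n} \<and> card (interior_peaks n p) = k}"

definition W_left :: "nat \<Rightarrow> nat \<Rightarrow> nat" where
  "W_left n k = card {p. p permutes {1..n} \<and> card (left_peaks n p) = k}"

lemma card_interior_peaks_le: "card (interior_peaks n p) \<le> n"
proof -
  have "card (interior_peaks n p) \<le> card {1..n}"
    by (rule card_mono) (auto simp: interior_peaks_def)
  then show ?thesis by simp
qed

lemma card_left_peaks_le: "card (left_peaks n p) \<le> n"
proof -
  have "card (left_peaks n p) \<le> card {1..n}"
    by (rule card_mono) (auto simp: left_peaks_def)
  then show ?thesis by simp
qed

lemma W_eq_0: "n < k \<Longrightarrow> W n k = 0"
  unfolding W_def using card_interior_peaks_le[of n] by (auto simp: card_eq_0_iff not_le[symmetric])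

lemma W_left_eq_0: "n < k \<Longrightarrow> W_left n k = 0"
  unfolding W_left_def using card_left_peaks_le[of n] by (auto simp: card_eq_0_iff not_le[symmetric])

text \<open>
  The sums over all \<open>k \<ge> 0\<close> are cut off at \<open>n\<close>, beyond which all terms vanish;
  cf. \<open>coeff_W_poly\<close> and \<open>coeff_W_left_poly\<close> below.
\<close>

definition W_poly :: "nat \<Rightarrow> int poly" where
  "W_poly n = (\<Sum>k\<le>n. monom (of_nat (W n k)) k)"

definition W_left_poly :: "nat \<Rightarrow> int poly" where
  "W_left_poly n = (\<Sum>k\<le>n. monom (of_nat (W_left n k)) k)"

lemma coeff_W_poly: "coeff (W_poly n) k = of_nat (W n k)"
  by (cases "k \<le> n") (simp_all add: W_poly_def coeff_sum W_eq_0)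

lemma coeff_W_left_poly: "coeff (W_left_poly n) k = of_nat (W_left n k)"
  by (cases "k \<le> n") (simp_all add: W_left_poly_def coeff_sum W_left_eq_0)

definition C_poly :: "nat \<Rightarrow> int poly" where
  "C_poly n = [:0, 1:] * pcompose (W_poly n) ([:0, 1:] ^ 2) + pcompose (W_left_poly n) ([:0, 1:] ^ 2)"

text \<open>
  A subsequence of length \<open>k\<close> is given by its strictly increasing sequence of positions
  \<open>idx 1 < \<dots> < idx k\<close>; the first comparison must be a descent.
\<close>

definition alternating_subseq :: "nat \<Rightarrow> (nat \<Rightarrow> nat) \<Rightarrow> nat \<Rightarrow> (nat \<Rightarrow> nat) \<Rightarrow> bool" where
  "alternating_subseq n p k idx \<longleftrightarrow>
     strict_mono_on {1..k} idx \<and> idx ` {1..k} \<subseteq> {1..n} \<and>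
     (\<forall>j\<in>{1..<k}. if odd j then p (idx j) > p (idx (j + 1)) else p (idx j) < p (idx (j + 1)))"

lemma alternating_subseq_length_le:
  assumes "alternating_subseq n p k idx"
  shows "k \<le> n"
proof -
  have "inj_on idx {1..k}" "idx ` {1..k} \<subseteq> {1..n}"
    using assms by (auto simp: alternating_subseq_def intro: strict_mono_on_imp_inj_on)
  then have "card {1..k} \<le> card {1..n}" by (rule card_inj_on_le) simp
  then show ?thesis by simp
qed

lemma finite_alternating_subseq_lengths: "finite {k. \<exists>idx. alternating_subseq n p k idx}"
  by (rule finite_subset[of _ "{..n}"]) (auto dest: alternating_subseq_length_le)

definition as_length :: "nat \<Rightarrow> (nat \<Rightarrow> nat) \<Rightarrow> nat" where
  "as_length n p = Max {k. \<exists>idx. alternating_subseq n p k idx}"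

definition as_count :: "nat \<Rightarrow> nat \<Rightarrow> nat" where
  "as_count k n = card {p. p permutes {1..n} \<and> as_length n p = k}"

definition T_poly :: "nat \<Rightarrow> int poly" where
  "T_poly n = (\<Sum>k = 1..n. monom (of_nat (as_count k n)) k)"

end

theory Submission
  imports Defs
begin

text \<open>
  Scanning \<open>p\<close> from left to right, a longest alternating subsequence can be kept ending at the
  current position: it is extended whenever the direction changes, and otherwise its last entry
  is moved.  Hence \<open>as(p) = 2 v + 1 + d\<close>, where \<open>v\<close> is the number of interior valleys and
  \<open>d\<close> is 1 or 0 according to whether \<open>p\<close> ends with a descent.  The reverse-complement \<open>q\<close> of \<open>p\<close>
  has \<open>v\<close> interior peaks and \<open>v + d\<close> left peaks, so the exponents \<open>2 v + 2\<close> and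
  \<open>2 (v + d) + 1\<close> that \<open>q\<close> contributes to \<open>x C\<^sub>n(x)\<close> are \<open>as(p)\<close> and \<open>as(p) + 1\<close> in some order.
\<close>

subsection \<open>Longest alternating subsequences\<close>

text \<open>The parity of the length built so far stores the direction that extends it: odd waits
  for a descent, even for an ascent. Position 0 is a sentinel: when \<open>p 0 < p 1\<close>, the
  first step counts position 1.\<close>

primrec greedy_alt_length :: "(nat \<Rightarrow> nat) \<Rightarrow> nat \<Rightarrow> nat" where
  "greedy_alt_length p 0 = 0"
| "greedy_alt_length p (Suc m) = greedy_alt_length p m +
     (if (if odd (greedy_alt_length p m) then p m > p (Suc m) else p m < p (Suc m)) then 1 else 0)"

lemma alternating_subseqD:
  assumes "alternating_subseq m p k idx"
  shows "i \<in> {1..k} \<Longrightarrow> j \<in> {1..k} \<Longrightarrow> i < j \<Longrightarrow> idx i < idx j"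
    and "j \<in> {1..k} \<Longrightarrow> idx j \<in> {1..m}"
    and "j \<in> {1..<k} \<Longrightarrow>
      if odd j then p (idx j) > p (idx (Suc j)) else p (idx j) < p (idx (Suc j))"
  using assms unfolding alternating_subseq_def strict_mono_on_def Suc_eq_plus1 by blast+

lemma alternating_subseq_prefix:
  assumes "alternating_subseq m p k idx" "k' \<le> k" "\<And>j. j \<in> {1..k'} \<Longrightarrow> idx j \<le> m'"
  shows "alternating_subseq m' p k' idx"
  unfolding alternating_subseq_def
proof (intro conjI strict_mono_onI ballI image_subsetI)
  fix j assume "j \<in> {1..k'}"
  with assms(3)[OF this] alternating_subseqD(2)[OF assms(1), of j] assms(2)
  show "idx j \<in> {1..m'}" by auto
next
  fix i j assume "i \<in> {1..k'}" "j \<in> {1..k'}" "i < j"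
  with alternating_subseqD(1)[OF assms(1), of i j] assms(2)
  show "idx i < idx j" by auto
next
  fix j assume "j \<in> {1..<k'}"
  with alternating_subseqD(3)[OF assms(1), of j] assms(2)
  show "if odd j then p (idx j) > p (idx (j + 1)) else p (idx j) < p (idx (j + 1))" by auto
qed

text \<open>The bound alone does not carry through the induction. The second clause adds that, among
  subsequences of greedy length, ending at \<open>p m\<close> leaves most room for the next turn: as
  high as possible before a descent, as low as possible before an ascent.\<close>

lemma alternating_subseq_le_greedy:
  assumes "m \<ge> 1" "p 0 < p 1" "alternating_subseq m p k idx"
  shows "k \<le> greedy_alt_length p m \<and> (k = greedy_alt_length p m \<longrightarrow>
    (if odd k then p (idx k) \<le> p m else p m \<le> p (idx k)))"
  using assms
proof (induction m arbitrary: k rule: nat_induct_at_least)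
  case base
  from alternating_subseq_length_le[OF base(2)] have k: "k \<le> 1" .
  moreover have "idx 1 = 1" if "k = 1"
    using base(2) that by (auto simp: alternating_subseq_def)
  ultimately show ?case using base(1) by (auto simp: le_Suc_eq)
next
  case (Suc m)
  let ?L = "greedy_alt_length p"
  have L1: "?L m \<ge> 1"
    using Suc.hyps Suc.prems(1) by (induction m rule: nat_induct_at_least) auto
  note sm = alternating_subseqD(1)[OF Suc.prems(2)]
    and rg = alternating_subseqD(2)[OF Suc.prems(2)]
  show ?case
  proof (cases "k \<ge> 1 \<and> idx k = Suc m")
    case False
    have "idx j \<le> m" if "j \<in> {1..k}" for j
      using rg[of k] rg[of j] sm[of j k] that False by (cases "j = k") auto
    then have "alternating_subseq m p k idx"
      using alternating_subseq_prefix[OF Suc.prems(2)] by blast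
    from Suc.IH[OF Suc.prems(1) this] show ?thesis by (auto split: if_splits)
  next
    case True
    have "idx j \<le> m" if "j \<in> {1..k - 1}" for j
      using sm[of j k] that True by (cases "j < k") auto
    then have "alternating_subseq m p (k - 1) idx"
      using alternating_subseq_prefix[OF Suc.prems(2)] by simp
    note IH = Suc.IH[OF Suc.prems(1) this]
    show ?thesis
    proof (cases "k - 1 = ?L m")
      case False
      \<comment> \<open>Here \<open>k\<close> is at most \<open>?L m\<close>, and the end condition
        is an equality because \<open>idx k = Suc m\<close>.\<close>
      then show ?thesis using IH True by auto
    next
      case eq: True
      then have k: "k = Suc (?L m)" using True by linarith
      \<comment> \<open>By the end condition for \<open>k - 1\<close>, the last turn of
        \<open>idx\<close> is also a turn from \<open>p m\<close> to \<open>p (Suc m)\<close>, so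
        the greedy length grows as well.\<close>
      have "if odd (?L m) then p (idx (?L m)) > p (idx k) else p (idx (?L m)) < p (idx k)"
        using alternating_subseqD(3)[OF Suc.prems(2), of "?L m"] L1 k by simp
      then show ?thesis using IH True eq by (auto split: if_splits)
    qed
  qed
qed

text \<open>Distinct neighbours matter when the scan does not extend: the step then continues
  strictly in the previous direction, so moving the last entry to the new position keeps the last
  comparison strict.\<close>

lemma greedy_alternating_subseq:
  assumes "m \<ge> 1" "p 0 < p 1" "\<And>i. i \<in> {1..<m} \<Longrightarrow> p i \<noteq> p (Suc i)"
  shows "\<exists>idx. alternating_subseq m p (greedy_alt_length p m) idx \<and>
    idx (greedy_alt_length p m) = m"
  using assms
proof (induction m rule: nat_induct_at_least)
  case base
  then show ?case
    by (intro exI[of _ id]) (auto simp: alternating_subseq_def strict_mono_on_def)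
next
  case (Suc m)
  let ?L = "greedy_alt_length p"
  from Suc obtain idx where idx: "alternating_subseq m p (?L m) idx" "idx (?L m) = m"
    by auto
  have ne: "p m \<noteq> p (Suc m)" using Suc.prems(2)[of m] Suc.hyps by auto
  have L1: "?L m \<ge> 1"
    using Suc.hyps Suc.prems(1) by (induction m rule: nat_induct_at_least) auto
  have LS: "?L (Suc m) = ?L m \<or> ?L (Suc m) = Suc (?L m)" by simp
  note sm = alternating_subseqD(1)[OF idx(1)] and rg = alternating_subseqD(2)[OF idx(1)]
    and alt = alternating_subseqD(3)[OF idx(1)]
  \<comment> \<open>One update serves both cases: it overwrites the last index if the length is
    unchanged and appends an index if it grows.\<close>
  define idx' where "idx' = idx(?L (Suc m) := Suc m)"
  have "strict_mono_on {1..?L (Suc m)} idx'"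
  proof (rule strict_mono_onI)
    fix i j assume ij: "i \<in> {1..?L (Suc m)}" "j \<in> {1..?L (Suc m)}" "i < j"
    with LS have i: "i \<in> {1..?L m}" "i \<noteq> ?L (Suc m)" by auto
    show "idx' i < idx' j"
    proof (cases "j = ?L (Suc m)")
      case True
      then show ?thesis using rg[OF i(1)] i(2) by (simp add: idx'_def del: greedy_alt_length.simps)
    next
      case False
      then show ?thesis using sm[of i j] i ij LS
        by (auto simp: idx'_def simp del: greedy_alt_length.simps)
    qed
  qed
  moreover have "idx' ` {1..?L (Suc m)} \<subseteq> {1..Suc m}"
  proof
    fix y assume "y \<in> idx' ` {1..?L (Suc m)}"
    then obtain j where j: "j \<in> {1..?L (Suc m)}" "y = idx' j" by blast
    then show "y \<in> {1..Suc m}" using rg[of j] LS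
      by (cases "j = ?L (Suc m)") (auto simp: idx'_def simp del: greedy_alt_length.simps)
  qed
  moreover have "if odd j then p (idx' j) > p (idx' (j + 1)) else p (idx' j) < p (idx' (j + 1))"
    if j: "j \<in> {1..<?L (Suc m)}" for j
  proof (cases "Suc j = ?L (Suc m)")
    case False
    then show ?thesis using alt[of j] j LS
      by (auto simp: idx'_def simp del: greedy_alt_length.simps)
  next
    case last: True
    then have "idx' (Suc j) = Suc m" "idx' j = idx j"
      by (auto simp: idx'_def simp del: greedy_alt_length.simps)
    moreover have "if odd j then p (idx j) > p (Suc m) else p (idx j) < p (Suc m)"
    \<comment> \<open>If the last entry is moved, the comparison follows by transitivity through
      \<open>p m\<close>; if an entry is appended, it is the greedy test itself.\<close>
    proof (cases "?L (Suc m) = ?L m")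
      case True
      with last have "Suc j = ?L m" by simp
      moreover have "if odd (?L m) then p m < p (Suc m) else p m > p (Suc m)"
        using True ne by (auto split: if_splits)
      moreover from \<open>Suc j = ?L m\<close> have "odd (?L m) \<longleftrightarrow> even j" by (metis even_Suc)
      ultimately show ?thesis using alt[of j] j idx(2)
        by (auto split: if_splits simp del: greedy_alt_length.simps)
    next
      case False
      with last LS have "j = ?L m" by (simp del: greedy_alt_length.simps)
      then show ?thesis using False idx(2) by (auto split: if_splits)
    qed
    ultimately show ?thesis by simp
  qed
  ultimately have "alternating_subseq (Suc m) p (?L (Suc m)) idx'"
    unfolding alternating_subseq_def by blast
  moreover have "idx' (?L (Suc m)) = Suc m" by (simp add: idx'_def)
  ultimately show ?case by blast
qed

lemma as_length_eq_greedy: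
  assumes "n \<ge> 1" "p 0 < p 1" "\<And>i. i \<in> {1..<n} \<Longrightarrow> p i \<noteq> p (Suc i)"
  shows "as_length n p = greedy_alt_length p n"
  unfolding as_length_def
proof (rule Max_eqI)
  show "greedy_alt_length p n \<in> {k. \<exists>idx. alternating_subseq n p k idx}"
    using greedy_alternating_subseq[OF assms] by blast
qed (use alternating_subseq_le_greedy[OF assms(1,2)] finite_alternating_subseq_lengths in auto)

section \<open>Greedy length in terms of valleys\<close>

definition valleys :: "nat \<Rightarrow> (nat \<Rightarrow> nat) \<Rightarrow> nat set" where
  "valleys n p = {i \<in> {1..<n}. p (i - 1) > p i \<and> p i < p (Suc i)}"

lemma finite_valleys [simp]: "finite (valleys n p)"
  by (simp add: valleys_def)

lemma valleys_Suc:
  assumes "m \<ge> 1"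
  shows "valleys (Suc m) p =
    (if p (m - 1) > p m \<and> p m < p (Suc m) then insert m (valleys m p) else valleys m p)"
  using assms by (auto simp: valleys_def less_Suc_eq)

text \<open>Turning from ascent to descent switches the final summand on; turning back switches it
  off but creates a valley worth 2. Each turn thus adds exactly 1, and the length is odd exactly
  when the last step rises.\<close>

lemma greedy_alt_length_eq_valleys:
  assumes "m \<ge> 1" "p 0 < p 1" "\<And>i. i \<in> {1..<m} \<Longrightarrow> p i \<noteq> p (Suc i)"
  shows "greedy_alt_length p m = 2 * card (valleys m p) + 1 + (if p (m - 1) > p m then 1 else 0)"
  using assms
proof (induction m rule: nat_induct_at_least)
  case base
  then show ?case by (auto simp: valleys_def)
next
  case (Suc m)
  have "p m \<noteq> p (Suc m)" using Suc.prems(2)[of m] Suc.hyps by auto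
  moreover have "m \<notin> valleys m p" by (simp add: valleys_def)
  moreover have "greedy_alt_length p m =
      2 * card (valleys m p) + 1 + (if p (m - 1) > p m then 1 else 0)"
    using Suc by simp
  ultimately show ?case using Suc.hyps by (auto simp: valleys_Suc)
qed

lemma as_length_permutes:
  assumes "p permutes {1..n}" "n \<ge> 1"
  shows "as_length n p = 2 * card (valleys n p) + 1 + (if p (n - 1) > p n then 1 else 0)"
proof -
  have inj: "p i \<noteq> p j" if "i \<noteq> j" for i j
    using permutes_inj[OF assms(1)] that by (auto dest: injD)
  have "p 0 < p 1" using inj[of 0 1] permutes_zero[OF assms(1)] by simp
  then show ?thesis
    using as_length_eq_greedy[of n p] greedy_alt_length_eq_valleys[of n p] inj assms(2) by simp
qed

subsection \<open>Reverse-complement\<close>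

text \<open>The identity outside \<open>{1..n}\<close> makes this a permutation in the sense of
  \<open>permutes\<close>.\<close>

definition reflect :: "nat \<Rightarrow> nat \<Rightarrow> nat" where
  "reflect n i = (if i \<in> {1..n} then n + 1 - i else i)"

definition rev_compl :: "nat \<Rightarrow> (nat \<Rightarrow> nat) \<Rightarrow> nat \<Rightarrow> nat" where
  "rev_compl n p = reflect n \<circ> p \<circ> reflect n"

lemma reflect_reflect [simp]: "reflect n (reflect n i) = i"
  by (auto simp: reflect_def)

lemma reflect_less_iff:
  "a \<in> {1..n} \<Longrightarrow> b \<in> {1..n} \<Longrightarrow> reflect n a < reflect n b \<longleftrightarrow> b < a"
  by (auto simp: reflect_def)

lemma reflect_permutes: "reflect n permutes {1..n}"
  unfolding permutes_def by (metis reflect_def reflect_reflect)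

lemma rev_compl_permutes: "p permutes {1..n} \<Longrightarrow> rev_compl n p permutes {1..n}"
  unfolding rev_compl_def by (intro permutes_compose reflect_permutes)

lemma rev_compl_rev_compl [simp]: "rev_compl n (rev_compl n p) = p"
  by (simp add: rev_compl_def fun_eq_iff)

lemma rev_compl_less_iff:
  assumes "p permutes {1..n}" "i \<in> {1..n}" "j \<in> {1..n}"
  shows "rev_compl n p i < rev_compl n p j \<longleftrightarrow> p (n + 1 - j) < p (n + 1 - i)"
proof -
  have "p (n + 1 - i) \<in> {1..n}" "p (n + 1 - j) \<in> {1..n}"
    unfolding permutes_in_image[OF assms(1)] using assms(2,3) by auto
  then have "reflect n (p (n + 1 - i)) < reflect n (p (n + 1 - j)) \<longleftrightarrow>
      p (n + 1 - j) < p (n + 1 - i)"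
    by (rule reflect_less_iff)
  moreover have "reflect n i = n + 1 - i" "reflect n j = n + 1 - j"
    using assms(2,3) by (simp_all add: reflect_def)
  ultimately show ?thesis by (simp add: rev_compl_def)
qed

text \<open>Reversing positions only swaps the two neighbours of an entry, while complementing
  values flips both comparisons with them.\<close>

lemma interior_peaks_rev_compl:
  assumes "p permutes {1..n}"
  shows "interior_peaks n (rev_compl n p) = reflect n ` valleys n p"
proof (intro set_eqI iffI)
  fix i assume i: "i \<in> interior_peaks n (rev_compl n p)"
  then have r: "2 \<le> i" "i \<le> n - 1" by (auto simp: interior_peaks_def)
  have e: "n + 1 - (i - 1) = Suc (n + 1 - i)" "n + 1 - (i + 1) = n + 1 - i - 1" using r by auto
  have "i - 1 \<in> {1..n}" "i \<in> {1..n}" "i + 1 \<in> {1..n}" "n + 1 - i \<in> {1..<n}" using r by auto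
  then have "n + 1 - i \<in> valleys n p"
    using i rev_compl_less_iff[OF assms, of "i - 1" i] rev_compl_less_iff[OF assms, of "i + 1" i]
    unfolding e by (simp add: interior_peaks_def valleys_def)
  moreover have "i = reflect n (n + 1 - i)" using r by (auto simp: reflect_def)
  ultimately show "i \<in> reflect n ` valleys n p" by blast
next
  fix i assume "i \<in> reflect n ` valleys n p"
  then obtain j where j: "j \<in> valleys n p" "i = reflect n j" by blast
  \<comment> \<open>A valley at 1 would need \<open>p 0 > p 1\<close>, but \<open>p 0 = 0\<close>.
    Hence both neighbours of \<open>j\<close> lie in \<open>{1..n}\<close>.\<close>
  have "j \<noteq> 1"
    using j permutes_zero[OF assms] by (auto simp: valleys_def)
  with j have r: "2 \<le> j" "j < n" "i = n + 1 - j" by (auto simp: valleys_def reflect_def)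
  have e: "n + 1 - i = j" "n + 1 - (i - 1) = Suc j" "n + 1 - (i + 1) = j - 1" using r by auto
  have "i - 1 \<in> {1..n}" "i \<in> {1..n}" "i + 1 \<in> {1..n}" "i \<in> {2..n - 1}" using r by auto
  then show "i \<in> interior_peaks n (rev_compl n p)"
    using j(1) rev_compl_less_iff[OF assms, of "i - 1" i] rev_compl_less_iff[OF assms, of "i + 1" i]
    unfolding e by (simp add: interior_peaks_def valleys_def)
qed

lemma left_peaks_eq_interior_peaks:
  assumes "p permutes {1..n}"
  shows "left_peaks n p = (if n \<ge> 2 \<and> p 1 > p 2 then {1} else {}) \<union> interior_peaks n p"
proof -
  have "p 1 \<noteq> p 0" using injD[OF permutes_inj[OF assms], of 1 0] by auto
  then have "p 1 > p 0" using permutes_zero[OF assms] by simp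
  then have "i \<in> left_peaks n p \<longleftrightarrow>
      i \<in> (if n \<ge> 2 \<and> p 1 > p 2 then {1} else {}) \<union> interior_peaks n p" for i
    by (cases "i = 1") (auto simp: left_peaks_def interior_peaks_def numeral_2_eq_2)
  then show ?thesis by blast
qed

lemma card_interior_peaks_rev_compl:
  assumes "p permutes {1..n}"
  shows "card (interior_peaks n (rev_compl n p)) = card (valleys n p)"
  unfolding interior_peaks_rev_compl[OF assms]
  by (intro card_image inj_onI) (metis reflect_reflect)

text \<open>A left peak that is not interior is an initial descent, and an initial descent of the
  reverse-complement is a final descent of \<open>p\<close>.\<close>

lemma card_left_peaks_rev_compl:
  assumes "p permutes {1..n}" "n \<ge> 1"
  shows "card (left_peaks n (rev_compl n p)) =
    card (valleys n p) + (if p (n - 1) > p n then 1 else 0)"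
proof -
  have "n \<ge> 2 \<and> rev_compl n p 1 > rev_compl n p 2 \<longleftrightarrow> p (n - 1) > p n"
  proof (cases "n \<ge> 2")
    case True
    then show ?thesis using rev_compl_less_iff[OF assms(1), of 2 1] by simp
  next
    case False
    \<comment> \<open>The right side now reads \<open>p 0 > p 1\<close>, which is false since
      \<open>p 0 = 0\<close>.\<close>
    then have "n = 1" using assms(2) by simp
    then show ?thesis using permutes_zero[OF assms(1)] by simp
  qed
  moreover have "1 \<notin> interior_peaks n (rev_compl n p)" "finite (interior_peaks n (rev_compl n p))"
    by (simp_all add: interior_peaks_def)
  ultimately show ?thesis
    unfolding left_peaks_eq_interior_peaks[OF rev_compl_permutes[OF assms(1)]]
    by (simp add: card_interior_peaks_rev_compl[OF assms(1)])
qed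

subsection \<open>Generating polynomials\<close>

text \<open>Turns generating polynomials given by counts into sums over permutations, which can then
  be compared term by term.\<close>

lemma sum_monom_card_fibre:
  assumes "finite S" "finite K" "f ` S \<subseteq> K"
  shows "(\<Sum>k\<in>K. monom (of_nat (card {p \<in> S. f p = k}) :: 'a :: comm_semiring_1) k) =
    (\<Sum>p\<in>S. monom 1 (f p))"
proof -
  have "(\<Sum>p\<in>S. monom (1 :: 'a) (f p)) = (\<Sum>k\<in>K. \<Sum>p\<in>{p \<in> S. f p = k}. monom 1 (f p))"
    by (rule sum.group[OF assms, symmetric])
  also have "\<dots> = (\<Sum>k\<in>K. monom (of_nat (card {p \<in> S. f p = k})) k)"
    by (intro sum.cong refl) (simp add: of_nat_monom mult_monom)
  finally show ?thesis ..
qed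

lemma W_poly_eq_sum: "W_poly n = (\<Sum>p | p permutes {1..n}. monom 1 (card (interior_peaks n p)))"
  using sum_monom_card_fibre[where 'a = int, of "{p. p permutes {1..n}}" "{..n}" "\<lambda>p. card (interior_peaks n p)"]
  by (auto simp: W_poly_def W_def finite_permutations card_interior_peaks_le image_subset_iff)

lemma W_left_poly_eq_sum: "W_left_poly n = (\<Sum>p | p permutes {1..n}. monom 1 (card (left_peaks n p)))"
  using sum_monom_card_fibre[where 'a = int, of "{p. p permutes {1..n}}" "{..n}" "\<lambda>p. card (left_peaks n p)"]
  by (auto simp: W_left_poly_def W_left_def finite_permutations card_left_peaks_le image_subset_iff)

lemma as_length_le: "as_length n p \<le> n"
proof -
  \<comment> \<open>The empty subsequence makes the set of lengths nonempty, so its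
    \<open>Max\<close> is attained.\<close>
  have "alternating_subseq n p 0 id" by (simp add: alternating_subseq_def)
  then have "as_length n p \<in> {k. \<exists>idx. alternating_subseq n p k idx}"
    unfolding as_length_def by (intro Max_in finite_alternating_subseq_lengths) blast
  then show ?thesis by (auto dest: alternating_subseq_length_le)
qed

lemma T_poly_eq_sum:
  assumes "n \<ge> 1"
  shows "T_poly n = (\<Sum>p | p permutes {1..n}. monom 1 (as_length n p))"
proof -
  \<comment> \<open>The sum in \<open>T_poly\<close> starts at 1, so positivity is needed; the
    valley formula supplies it.\<close>
  have "as_length n ` {p. p permutes {1..n}} \<subseteq> {1..n}"
  proof (rule image_subsetI)
    fix p assume "p \<in> {p. p permutes {1..n}}"
    then show "as_length n p \<in> {1..n}"
      using as_length_permutes[OF _ assms, of p] as_length_le[of n p] by simp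
  qed
  from sum_monom_card_fibre[where 'a = int, OF _ _ this] show ?thesis
    by (simp add: T_poly_def as_count_def finite_permutations)
qed

lemma pcompose_monom_X_power:
  "pcompose (monom c k) ([:0, 1:] ^ d) = monom c (d * k)" for c :: "'a :: comm_semiring_1"
proof (induction k)
  case (Suc k)
  then show ?case by (simp add: monom_Suc[of c k] pcompose_pCons monom_altdef power_add mult.commute)
qed (simp add: monom_0)

lemma C_poly_eq_sum:
  "[:0, 1:] * C_poly n = (\<Sum>p | p permutes {1..n}.
     monom 1 (2 * card (interior_peaks n p) + 2) + monom 1 (2 * card (left_peaks n p) + 1))"
  unfolding C_poly_def W_poly_eq_sum W_left_poly_eq_sum pcompose_sum sum.distrib
    pcompose_monom_X_power
  by (simp add: monom_Suc distrib_left sum_distrib_left)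

theorem theorem3:
  fixes n :: nat
  assumes "n \<ge> 2"
  shows "[:0, 1:] * C_poly n = [:1, 1:] * T_poly n"
proof -
  let ?S = "{p. p permutes {1..n}}"
  have n: "n \<ge> 1" using assms by simp
  have "[:0, 1:] * C_poly n = (\<Sum>p\<in>?S. monom 1 (2 * card (interior_peaks n (rev_compl n p)) + 2) +
      monom 1 (2 * card (left_peaks n (rev_compl n p)) + 1))"
    unfolding C_poly_eq_sum
    by (rule sum.reindex_bij_witness[where i = "rev_compl n" and j = "rev_compl n"])
      (simp_all add: rev_compl_permutes del: One_nat_def)
  \<comment> \<open>Let \<open>v\<close> count the valleys. Without a final descent the exponents
    \<open>2 v + 2\<close> and \<open>2 v + 1\<close> are \<open>as(p) + 1\<close> and
    \<open>as(p)\<close>; with one, \<open>2 v + 2\<close> and \<open>2 v + 3\<close> are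
    \<open>as(p)\<close> and \<open>as(p) + 1\<close>.\<close>
  also have "\<dots> = (\<Sum>p\<in>?S. [:1, 1:] * monom 1 (as_length n p))"
    by (intro sum.cong refl)
      (simp add: card_interior_peaks_rev_compl card_left_peaks_rev_compl[OF _ n]
        as_length_permutes[OF _ n] monom_Suc)
  also have "\<dots> = [:1, 1:] * T_poly n"
    by (simp add: T_poly_eq_sum[OF n] sum_distrib_left)
  finally show ?thesis .
qed

end
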